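(* Let $G$ be a finite group. Then $G$ has class generating number $d$ if and only if $d$ is minimal with the property that the character table of $G$ contains a $d$-vertical cut with no row, except the first, having all entries equal.
   Context: A set of conjugacy classes of $G$ generates $G$ if the set of all elements in these classes generates $G$. The class generating number of $G$ is the minimal number of conjugacy classes that generates $G$. The character table of $G$ is the table of values of the irreducible complex characters (rows) on conjugacy classes (columns), written so that the first row corresponds to the principal (trivial) character and the first column to the conjugacy class of the identity. An $s$-vertical cut is a set of $1+s$ columns of the character table that includes column 1; a row of the cut is the restriction of a row of the character table to these $1+s$ columns. *)

theory Defs
  imports
    "HOL-Algebra.Group_Action"
    "HOL-Algebra.Generated_Groups"
    "Jordan_Normal_Form.VS_Connect"
begin

definition conjugacy_classes :: "('a, 'm) monoid_scheme \<Rightarrow> 'a set set" where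
  "conjugacy_classes G =
     orbits G (carrier G)
       (\<lambda>g. \<lambda>h \<in> carrier G. g \<otimes>\<^bsub>G\<^esub> h \<otimes>\<^bsub>G\<^esub> inv\<^bsub>G\<^esub> g)"

definition classes_generate :: "('a, 'm) monoid_scheme \<Rightarrow> 'a set set \<Rightarrow> bool" where
  "classes_generate G S \<longleftrightarrow>
     S \<subseteq> conjugacy_classes G \<and> generate G (\<Union>S) = carrier G"

text \<open>The empty set of classes is allowed, so the trivial group has class generating number 0.\<close>

definition class_generating_number :: "('a, 'm) monoid_scheme \<Rightarrow> nat" where
  "class_generating_number G =
     (LEAST d. \<exists>S. finite S \<and> card S = d \<and> classes_generate G S)"

definition representation ::
    "('a, 'm) monoid_scheme \<Rightarrow> nat \<Rightarrow> ('a \<Rightarrow> complex mat) \<Rightarrow> bool" where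
  "representation G n \<rho> \<longleftrightarrow> \<rho> \<in> hom G (units_of (ring_mat TYPE(complex) n ()))"

definition irreducible_representation ::
    "('a, 'm) monoid_scheme \<Rightarrow> nat \<Rightarrow> ('a \<Rightarrow> complex mat) \<Rightarrow> bool" where
  "irreducible_representation G n \<rho> \<longleftrightarrow>
     representation G n \<rho> \<and> n > 0 \<and>
     (\<forall>W. VectorSpace.subspace class_ring W (module_vec TYPE(complex) n) \<and>
          (\<forall>g \<in> carrier G. \<forall>w \<in> W. \<rho> g *\<^sub>v w \<in> W) \<longrightarrow>
          W = {0\<^sub>v n} \<or> W = carrier_vec n)"

definition mat_trace :: "'b :: comm_monoid_add mat \<Rightarrow> 'b" where
  "mat_trace A = (\<Sum>i < dim_row A. A $$ (i, i))"

text \<open>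
  Characters are made extensional, so that two of them are the same row of the character table
  precisely when they agree on the group.
\<close>

definition character_of ::
    "('a, 'm) monoid_scheme \<Rightarrow> ('a \<Rightarrow> complex mat) \<Rightarrow> 'a \<Rightarrow> complex" where
  "character_of G \<rho> = (\<lambda>g \<in> carrier G. mat_trace (\<rho> g))"

definition irreducible_characters :: "('a, 'm) monoid_scheme \<Rightarrow> ('a \<Rightarrow> complex) set" where
  "irreducible_characters G =
     {character_of G \<rho> | n \<rho>. irreducible_representation G n \<rho>}"

definition principal_character :: "('a, 'm) monoid_scheme \<Rightarrow> 'a \<Rightarrow> complex" where
  "principal_character G = (\<lambda>g \<in> carrier G. 1)"

text \<open>
  Rows are indexed by the irreducible characters themselves and columns by the conjugacy classes;
  the first row is the one of the principal character and the first column the one of the class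
  of the identity. An entry is the single value taken by the character on the class.
\<close>

definition character_table :: "('a \<Rightarrow> complex) \<Rightarrow> 'a set \<Rightarrow> complex" where
  "character_table \<chi> K = the_elem (\<chi> ` K)"

definition vertical_cut :: "('a, 'm) monoid_scheme \<Rightarrow> nat \<Rightarrow> 'a set set \<Rightarrow> bool" where
  "vertical_cut G s C \<longleftrightarrow>
     C \<subseteq> conjugacy_classes G \<and> {\<one>\<^bsub>G\<^esub>} \<in> C \<and> finite C \<and> card C = 1 + s"

definition cut_row :: "'a set set \<Rightarrow> ('a \<Rightarrow> complex) \<Rightarrow> 'a set \<Rightarrow> complex" where
  "cut_row C \<chi> = restrict (character_table \<chi>) C"

definition all_entries_equal :: "'a set set \<Rightarrow> ('a set \<Rightarrow> complex) \<Rightarrow> bool" where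
  "all_entries_equal C r \<longleftrightarrow> (\<forall>K \<in> C. \<forall>L \<in> C. r K = r L)"

text \<open>
  Rows are told apart by their index: a row of the cut belonging to a non-principal character
  counts even if its entries coincide with those of the first row.
\<close>

definition only_first_row_constant ::
    "('a, 'm) monoid_scheme \<Rightarrow> 'a set set \<Rightarrow> bool" where
  "only_first_row_constant G C \<longleftrightarrow>
     (\<forall>\<chi> \<in> irreducible_characters G - {principal_character G}.
        \<not> all_entries_equal C (cut_row C \<chi>))"

end

theory Submission
  imports Defs "Jordan_Normal_Form.Schur_Decomposition" "HOL-Algebra.Multiplicative_Group"
begin

text \<open>
  For a representation \<open>\<rho>\<close> of degree \<open>n\<close> of a finite group, the trace of \<open>\<rho> g\<close> is a sum of \<open>n\<close> roots
  of unity, so it equals \<open>n\<close> only if \<open>\<rho> g = 1\<close>. A row of a cut \<open>C\<close> is therefore constant iff the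
  normal subgroup \<open>N\<close> generated by the classes in \<open>C\<close> lies in the kernel of \<open>\<rho>\<close>. If \<open>N = G\<close> this forces
  the principal character. If \<open>N \<noteq> G\<close>, some nontrivial irreducible representation has \<open>N\<close> in its
  kernel. Hence the cuts in question are exactly the generating sets of classes, with the class of
  the identity adjoined.
\<close>

section \<open>Traces, triangular matrices and matrices of finite order\<close>

lemma mat_trace_mult_comm:
  fixes A B :: "'a :: comm_semiring_0 mat"
  assumes "A \<in> carrier_mat n m" "B \<in> carrier_mat m n"
  shows "mat_trace (A * B) = mat_trace (B * A)"
proof -
  have "mat_trace (A * B) = (\<Sum>i<n. \<Sum>j<m. A $$ (i, j) * B $$ (j, i))"
    using assms by (auto simp: mat_trace_def scalar_prod_def lessThan_atLeast0 intro!: sum.cong)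
  also have "\<dots> = (\<Sum>j<m. \<Sum>i<n. B $$ (j, i) * A $$ (i, j))"
    by (subst sum.swap) (simp add: mult.commute)
  also have "\<dots> = mat_trace (B * A)"
    using assms by (auto simp: mat_trace_def scalar_prod_def lessThan_atLeast0 intro!: sum.cong)
  finally show ?thesis .
qed

lemma mat_trace_similar:
  fixes A :: "'a :: comm_ring_1 mat"
  assumes A: "A \<in> carrier_mat n n" and PQ: "P \<in> carrier_mat n n" "Q \<in> carrier_mat n n"
    and inv: "Q * P = 1\<^sub>m n"
  shows "mat_trace (P * A * Q) = mat_trace A"
proof -
  have "mat_trace (P * A * Q) = mat_trace (Q * (P * A))"
    by (rule mat_trace_mult_comm) (use A PQ in auto)
  also have "Q * (P * A) = A"
    using A PQ inv by (simp flip: assoc_mult_mat)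
  finally show ?thesis .
qed

lemma index_mult_mat_sum:
  assumes "A \<in> carrier_mat n m" "B \<in> carrier_mat m k" "i < n" "j < k"
  shows "(A * B) $$ (i, j) = (\<Sum>l<m. A $$ (i, l) * B $$ (l, j))"
  using assms by (auto simp: scalar_prod_def lessThan_atLeast0 intro!: sum.cong)

text \<open>Used to see that the diagonal entries of a triangular matrix of finite order are roots
  of unity.\<close>

lemma upper_triangular_pow_mat:
  fixes B :: "'a :: comm_ring_1 mat"
  assumes B: "B \<in> carrier_mat n n" and ut: "upper_triangular B"
  shows "\<lbrakk>i < n; j \<le> i\<rbrakk> \<Longrightarrow> (B ^\<^sub>m k) $$ (i, j) = (if i = j then (B $$ (i, i)) ^ k else 0)"
proof (induction k arbitrary: i j)
  case 0
  then show ?case using B by auto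
next
  case (Suc k)
  have lower: "B $$ (l, j) = 0" if "j < l" "l < n" for l
    using ut that B by auto
  have "(B ^\<^sub>m Suc k) $$ (i, j) = (\<Sum>l<n. (B ^\<^sub>m k) $$ (i, l) * B $$ (l, j))"
    using B Suc.prems by (simp del: index_mult_mat add: index_mult_mat_sum[where n=n and m=n and k=n])
  \<comment> \<open>For \<open>l < i\<close> the entry \<open>(i, l)\<close> of the power vanishes
    by induction; for \<open>l > i \<ge> j\<close> the entry \<open>(l, j)\<close> of
    \<open>B\<close> does.\<close>
  also have "\<dots> = (\<Sum>l<n. if l = i then (B $$ (i, i)) ^ k * B $$ (i, j) else 0)"
  proof (rule sum.cong)
    fix l assume l: "l \<in> {..<n}"
    show "(B ^\<^sub>m k) $$ (i, l) * B $$ (l, j) = (if l = i then (B $$ (i, i)) ^ k * B $$ (i, j) else 0)"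
    proof (cases "l \<le> i")
      case True
      then show ?thesis using Suc.IH[of i l] Suc.prems by auto
    next
      case False
      then show ?thesis using lower[of l] Suc.prems l by auto
    qed
  qed simp
  also have "\<dots> = (B $$ (i, i)) ^ k * B $$ (i, j)"
    using Suc.prems by simp
  finally show ?case using lower[of i] Suc.prems by (auto simp: mult.commute)
qed

text \<open>On the lowest nonzero superdiagonal of \<open>B - 1\<close>, taking the \<open>k\<close>-th power multiplies
  by \<open>k\<close>, so in characteristic 0 a unipotent matrix of finite order is trivial.\<close>

lemma unipotent_finite_order:
  fixes B :: "'a :: {idom, ring_char_0} mat"
  assumes B: "B \<in> carrier_mat n n" and ut: "upper_triangular B"
    and diag: "\<And>i. i < n \<Longrightarrow> B $$ (i, i) = 1"
    and m: "m > 0" "B ^\<^sub>m m = 1\<^sub>m n"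
  shows "B = 1\<^sub>m n"
proof -
  have low: "B $$ (i, j) = (if i = j then 1 else 0)" if "i < n" "j \<le> i" for i j
    using ut B diag that by auto
  have zero: "B $$ (i, i + d) = 0" if "d > 0" "i + d < n" for i d
    using that
  proof (induction d arbitrary: i rule: less_induct)
    case (less d)
    \<comment> \<open>By induction over the superdiagonals, \<open>B\<close> agrees with the
      identity strictly below the \<open>d\<close>-th one.\<close>
    have near: "B $$ (l, j) = (if l = j then 1 else 0)" if "l < n" "j < l + d" "j < n" for l j
    proof (cases "j \<le> l")
      case False
      then show ?thesis using less.IH[of "j - l" l] that by auto
    qed (use low that in auto)
    \<comment> \<open>Row \<open>i\<close> of the power, up to column \<open>i + d\<close>. In the
      product with one more factor \<open>B\<close> only \<open>l = i\<close> and
      \<open>l = i + d\<close> contribute, since columns beyond \<open>i + d\<close> meet the zero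
      part of \<open>B\<close>; each factor adds one more copy of \<open>B $$ (i, i + d)\<close> in
      column \<open>i + d\<close>.\<close>
    have "(B ^\<^sub>m k) $$ (i, j) =
        (if j = i + d then of_nat k * B $$ (i, i + d) else if i = j then 1 else 0)"
      if "j \<le> i + d" for k j
      using that
    proof (induction k arbitrary: j)
      case 0
      then show ?case using B less.prems by auto
    next
      case (Suc k)
      have jn: "j < n" using Suc.prems less.prems by auto
      have "(B ^\<^sub>m Suc k) $$ (i, j) = (\<Sum>l<n. (B ^\<^sub>m k) $$ (i, l) * B $$ (l, j))"
        using B less.prems jn
        by (simp del: index_mult_mat add: index_mult_mat_sum[where n=n and m=n and k=n])
      also have "\<dots> = (\<Sum>l<n. (if l = i then B $$ (i, j) else 0)
          + (if l = i + d then of_nat k * B $$ (i, i + d) * B $$ (l, j) else 0))"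
      proof (rule sum.cong)
        fix l assume l: "l \<in> {..<n}"
        consider "l \<le> i + d" | "l > i + d" by linarith
        then show "(B ^\<^sub>m k) $$ (i, l) * B $$ (l, j) = (if l = i then B $$ (i, j) else 0)
          + (if l = i + d then of_nat k * B $$ (i, i + d) * B $$ (l, j) else 0)"
        proof cases
          case 1
          then show ?thesis using Suc.IH[OF 1] less.prems by auto
        next
          case 2
          then show ?thesis using low[of l j] l Suc.prems by auto
        qed
      qed simp
      also have "\<dots> = B $$ (i, j) + of_nat k * B $$ (i, i + d) * B $$ (i + d, j)"
        using less.prems by (simp add: sum.distrib)
      also have "\<dots> = (if j = i + d then of_nat (Suc k) * B $$ (i, i + d) else if i = j then 1 else 0)"
        using low[of "i + d" j] near[of i j] Suc.prems less.prems jn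
        by (auto simp: algebra_simps)
      finally show ?case .
    qed
    \<comment> \<open>At \<open>k = m\<close> this off-diagonal entry is \<open>m\<close> times
      \<open>B $$ (i, i + d)\<close> and is an entry of the identity matrix, so it is zero.\<close>
    from this[of "i + d" m] show ?case using m less.prems by auto
  qed
  show ?thesis
  proof (rule eq_matI)
    fix i j assume "i < dim_row (1\<^sub>m n :: 'a mat)" "j < dim_col (1\<^sub>m n :: 'a mat)"
    then show "B $$ (i, j) = 1\<^sub>m n $$ (i, j)"
      using low[of i j] zero[of "j - i" i] by (cases "j \<le> i") auto
  qed (use B in auto)
qed

text \<open>Every \<open>z i\<close> has modulus 1, hence real part at most 1. The real parts sum to
  \<open>n\<close>, so each of them is 1, and then modulus 1 leaves no imaginary part.\<close>

lemma sum_roots_of_unity_maximal: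
  fixes z :: "nat \<Rightarrow> complex"
  assumes root: "\<And>i. i < n \<Longrightarrow> z i ^ m = 1" and m: "m > 0"
    and sum: "(\<Sum>i<n. z i) = of_nat n" and i: "i < n"
  shows "z i = 1"
proof -
  have norm: "cmod (z j) = 1" if "j < n" for j
    using arg_cong[OF root[OF that], of cmod] m power_eq_imp_eq_base[of "cmod (z j)" m 1]
    by (simp add: norm_power)
  have le: "Re (z j) \<le> 1" if "j < n" for j
    using complex_Re_le_cmod[of "z j"] norm[OF that] by simp
  have "(\<Sum>j<n. 1 - Re (z j)) = 0"
    using arg_cong[OF sum, of Re] by (simp add: sum_subtractf)
  then have "1 - Re (z i) = 0"
    using le i by (subst (asm) sum_nonneg_eq_0_iff) auto
  moreover from this norm[OF i] have "Im (z i) = 0"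
    by (simp add: cmod_def)
  ultimately show ?thesis by (simp add: complex_eq_iff)
qed

text \<open>Over the complex numbers \<open>A\<close> is similar to an upper triangular
  \<open>B\<close> with the same order and trace. The diagonal of \<open>B\<close> consists of roots
  of unity with sum \<open>n\<close>, hence of ones, so \<open>B\<close> is unipotent of finite
  order and thus trivial.\<close>

lemma finite_order_mat_trace_maximal:
  fixes A :: "complex mat"
  assumes A: "A \<in> carrier_mat n n" and m: "m > 0" "A ^\<^sub>m m = 1\<^sub>m n"
    and tr: "mat_trace A = of_nat n"
  shows "A = 1\<^sub>m n"
proof -
  obtain es where "char_poly A = (\<Prod>a \<leftarrow> es. [:- a, 1:])"
    using char_poly_factorized[OF A] by blast
  then obtain B where B: "B \<in> carrier_mat n n" and ut: "upper_triangular B" and sim: "similar_mat A B"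
    using schur_decomposition_exists[OF A] by blast
  from sim obtain P Q where wit: "similar_mat_wit A B P Q"
    unfolding similar_mat_def by blast
  from similar_mat_witD2[OF A wit] have PQ: "P * Q = 1\<^sub>m n" "Q * P = 1\<^sub>m n" "A = P * B * Q"
    "P \<in> carrier_mat n n" "Q \<in> carrier_mat n n" by auto
  have "similar_mat_wit B A Q P" by (rule similar_mat_wit_sym[OF wit])
  then have "B ^\<^sub>m m = Q * A ^\<^sub>m m * P"
    by (rule similar_mat_wit_pow_id)
  then have Bm: "B ^\<^sub>m m = 1\<^sub>m n"
    using PQ m by simp
  have root: "(B $$ (i, i)) ^ m = 1" if "i < n" for i
    using upper_triangular_pow_mat[OF B ut that order_refl, of m] Bm that by simp
  have "mat_trace B = of_nat n"
    using mat_trace_similar[OF B PQ(4,5,2)] PQ(3) tr by simp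
  then have "(\<Sum>i<n. B $$ (i, i)) = of_nat n"
    using B by (simp add: mat_trace_def)
  then have "B $$ (i, i) = 1" if "i < n" for i
    using sum_roots_of_unity_maximal[where z = "\<lambda>i. B $$ (i, i)", OF root m(1)] that by blast
  then have "B = 1\<^sub>m n"
    using unipotent_finite_order[OF B ut _ m(1) Bm] by blast
  then show ?thesis using PQ by simp
qed

section \<open>Subspaces as images of injective matrices\<close>

lemma subspace_carrier_vec_iff:
  fixes W :: "'a :: field vec set"
  shows "VectorSpace.subspace class_ring W (module_vec TYPE('a) n) \<longleftrightarrow>
    W \<subseteq> carrier_vec n \<and> 0\<^sub>v n \<in> W \<and> (\<forall>v \<in> W. \<forall>w \<in> W. v + w \<in> W) \<and> (\<forall>c. \<forall>v \<in> W. c \<cdot>\<^sub>v v \<in> W)"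
  unfolding VectorSpace.subspace_def submodule_def
  using vec_module[where 'a='a] vec_vs[where 'a='a] by (auto simp: module_vec_simps)

lemma mult_mat_vec_unit:
  fixes A :: "'a :: semiring_1 mat"
  assumes "A \<in> carrier_mat n k" "j < k"
  shows "A *\<^sub>v unit_vec k j = col A j"
  using assms by (intro eq_vecI) auto

text \<open>Encodes a \<open>k\<close>-dimensional subspace of the column space together with a
  basis, namely the columns of \<open>P\<close>. Dimensions become matrix sizes, and a linear map
  preserving the subspace becomes a matrix of size \<open>k\<close>.\<close>

definition mat_injective :: "nat \<Rightarrow> nat \<Rightarrow> 'a :: field mat \<Rightarrow> bool" where
  "mat_injective n k P \<longleftrightarrow>
     P \<in> carrier_mat n k \<and> (\<forall>v \<in> carrier_vec k. P *\<^sub>v v = 0\<^sub>v n \<longrightarrow> v = 0\<^sub>v k)"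

lemma mat_injective_carrier: "mat_injective n k P \<Longrightarrow> P \<in> carrier_mat n k"
  by (simp add: mat_injective_def)

lemma mat_injective_zero: "\<lbrakk>mat_injective n k P; v \<in> carrier_vec k; P *\<^sub>v v = 0\<^sub>v n\<rbrakk> \<Longrightarrow> v = 0\<^sub>v k"
  by (simp add: mat_injective_def)

lemma mat_injective_vec_eq:
  assumes P: "mat_injective n k P" and v: "v \<in> carrier_vec k" and w: "w \<in> carrier_vec k"
    and eq: "P *\<^sub>v v = P *\<^sub>v w"
  shows "v = w"
proof -
  note Pc = mat_injective_carrier[OF P]
  have "P *\<^sub>v (v - w) = 0\<^sub>v n"
    using Pc v w eq by (simp add: mult_minus_distrib_mat_vec)
  then have "v - w = 0\<^sub>v k"
    using mat_injective_zero[OF P, of "v - w"] v w by simp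
  then have "v $ i - w $ i = 0" if "i < k" for i
  proof -
    have "(v - w) $ i = 0" using \<open>v - w = 0\<^sub>v k\<close> that by simp
    then show ?thesis using w that by simp
  qed
  then show ?thesis using v w by (intro eq_vecI) auto
qed

lemma mat_injective_cancel:
  assumes P: "mat_injective n k P" and X: "X \<in> carrier_mat k l" and Y: "Y \<in> carrier_mat k l"
    and eq: "P * X = P * Y"
  shows "X = Y"
proof (rule mat_col_eqI)
  fix j assume "j < dim_col Y"
  then have j: "j < l" using Y by auto
  have "P *\<^sub>v col X j = col (P * X) j"
    by (rule col_mult2[OF mat_injective_carrier[OF P] X j, symmetric])
  also have "\<dots> = P *\<^sub>v col Y j"
    unfolding eq by (rule col_mult2[OF mat_injective_carrier[OF P] Y j])
  finally show "col X j = col Y j"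
    by (rule mat_injective_vec_eq[OF P, rotated 2]) (use X Y j in auto)
qed (use X Y in auto)

lemma mat_injective_mult:
  assumes P: "mat_injective n k P" and Q: "mat_injective k l Q"
  shows "mat_injective n l (P * Q)"
  unfolding mat_injective_def
  using mat_injective_carrier[OF P] mat_injective_carrier[OF Q]
    mat_injective_zero[OF P] mat_injective_zero[OF Q]
  by (auto simp: assoc_mult_mat_vec)

text \<open>More unknowns than equations give a nonzero solution. This is obtained from determinants
  by padding \<open>P\<close> to a square matrix.\<close>

lemma mat_injective_le:
  fixes P :: "'a :: field mat"
  assumes P: "mat_injective n k P"
  shows "k \<le> n"
proof (rule ccontr)
  assume "\<not> k \<le> n"
  then have nk: "n < k" by simp
  note Pc = mat_injective_carrier[OF P]
  \<comment> \<open>Zero rows are added below \<open>P\<close>. Row \<open>n\<close> of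
    \<open>S\<close> is zero, so the transpose kills the unit vector with index \<open>n\<close> and
    \<open>S\<close> is singular; a kernel vector of \<open>S\<close> is also one of
    \<open>P\<close>.\<close>
  define S where "S = mat k k (\<lambda>(i, j). if i < n then P $$ (i, j) else 0)"
  have S: "S \<in> carrier_mat k k" by (simp add: S_def)
  have "transpose_mat S *\<^sub>v unit_vec k n = 0\<^sub>v k"
    using nk by (intro eq_vecI) (auto simp: S_def)
  moreover have "unit_vec k n \<noteq> (0\<^sub>v k :: 'a vec)"
    using nk by (metis index_unit_vec(2) index_zero_vec(1) zero_neq_one)
  ultimately have "\<exists>v. v \<in> carrier_vec k \<and> v \<noteq> 0\<^sub>v k \<and> transpose_mat S *\<^sub>v v = 0\<^sub>v k"
    by (intro exI[of _ "unit_vec k n"]) simp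
  then have "det (transpose_mat S) = 0"
    using det_0_iff_vec_prod_zero_field[of "transpose_mat S" k] S by simp
  then have "det S = 0" using det_transpose[OF S] by simp
  then obtain v where v: "v \<in> carrier_vec k" "v \<noteq> 0\<^sub>v k" "S *\<^sub>v v = 0\<^sub>v k"
    using det_0_iff_vec_prod_zero_field[OF S] by auto
  have "P *\<^sub>v v = 0\<^sub>v n"
  proof (rule eq_vecI)
    fix i assume "i < dim_vec (0\<^sub>v n :: 'a vec)"
    then have i: "i < n" by simp
    then have "row S i = row P i"
      using Pc nk by (intro eq_vecI) (auto simp: S_def)
    moreover have "(S *\<^sub>v v) $ i = 0" using v(3) i nk by simp
    ultimately show "(P *\<^sub>v v) $ i = 0\<^sub>v n $ i"
      using i nk Pc S by simp
  qed (use Pc in auto)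
  then show False using mat_injective_zero[OF P v(1)] v(2) by simp
qed

text \<open>Turns equality of dimensions into equality of spaces: an injective square matrix has
  nonzero determinant, hence a right inverse.\<close>

lemma mat_injective_square_surj:
  assumes P: "mat_injective n n P"
  shows "(\<lambda>v. P *\<^sub>v v) ` carrier_vec n = carrier_vec n"
proof -
  note Pc = mat_injective_carrier[OF P]
  have "det P \<noteq> 0"
    using det_0_iff_vec_prod_zero_field[OF Pc] mat_injective_zero[OF P] by auto
  from det_non_zero_imp_unit[OF Pc this]
  obtain Q where Q: "Q \<in> carrier_mat n n" "P * Q = 1\<^sub>m n"
    by (auto simp: Units_def ring_mat_simps)
  have "w \<in> (\<lambda>v. P *\<^sub>v v) ` carrier_vec n" if w: "w \<in> carrier_vec n" for w
  proof
    show "w = P *\<^sub>v (Q *\<^sub>v w)"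
      using Pc Q w by (simp flip: assoc_mult_mat_vec)
  qed (use Q w in auto)
  then show ?thesis using Pc by auto
qed

text \<open>Existence of a basis: take an injective matrix with image inside \<open>W\<close> and as
  many columns as possible. A vector of \<open>W\<close> outside the image could be appended as a
  further column.\<close>

lemma subspace_injective_image:
  fixes W :: "'a :: field vec set"
  assumes W: "VectorSpace.subspace class_ring W (module_vec TYPE('a) n)"
  obtains k P where "mat_injective n k P" "(\<lambda>v. P *\<^sub>v v) ` carrier_vec k = W"
proof -
  have sub: "W \<subseteq> carrier_vec n" "0\<^sub>v n \<in> W"
    and add: "\<And>v w. v \<in> W \<Longrightarrow> w \<in> W \<Longrightarrow> v + w \<in> W"
    and smult: "\<And>c v. v \<in> W \<Longrightarrow> c \<cdot>\<^sub>v v \<in> W"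
    using W unfolding subspace_carrier_vec_iff by auto
  define K where "K = {k. \<exists>P. mat_injective n k P \<and> (\<forall>v \<in> carrier_vec k. P *\<^sub>v v \<in> W)}"
  have fin: "finite K"
    by (rule finite_subset[of _ "{..n}"]) (auto simp: K_def dest: mat_injective_le)
  \<comment> \<open>The matrix without columns is injective because \<open>carrier_vec 0\<close>
    contains only the empty vector; so the maximum of \<open>K\<close> exists.\<close>
  have "0 \<in> K"
  proof -
    have "(0\<^sub>m n 0 :: 'a mat) *\<^sub>v v = 0\<^sub>v n" if "v \<in> carrier_vec 0" for v
      using that by (intro eq_vecI) (auto simp: scalar_prod_def)
    then show ?thesis
      using sub unfolding K_def mat_injective_def by (auto intro!: exI[of _ "0\<^sub>m n 0"])
  qed
  define k where "k = Max K"
  have "k \<in> K" unfolding k_def using fin \<open>0 \<in> K\<close> by (intro Max_in) auto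
  then obtain P where P: "mat_injective n k P" and im: "\<And>v. v \<in> carrier_vec k \<Longrightarrow> P *\<^sub>v v \<in> W"
    unfolding K_def by auto
  note Pc = mat_injective_carrier[OF P]
  have "w \<in> (\<lambda>v. P *\<^sub>v v) ` carrier_vec k" if w: "w \<in> W" for w
  proof (rule ccontr)
    assume notin: "w \<notin> (\<lambda>v. P *\<^sub>v v) ` carrier_vec k"
    have wc: "w \<in> carrier_vec n" using w sub by auto
    \<comment> \<open>\<open>P'\<close> is \<open>P\<close> with \<open>w\<close> appended as last
      column, and \<open>r\<close> drops the last coordinate of a vector.\<close>
    define P' where "P' = mat n (Suc k) (\<lambda>(i, j). if j < k then P $$ (i, j) else w $ i)"
    define r where "r = (\<lambda>v :: 'a vec. vec k (\<lambda>i. v $ i))"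
    have P'c: "P' \<in> carrier_mat n (Suc k)" by (simp add: P'_def)
    have rc: "r v \<in> carrier_vec k" for v by (simp add: r_def)
    have P'v: "P' *\<^sub>v v = P *\<^sub>v r v + (v $ k) \<cdot>\<^sub>v w" if v: "v \<in> carrier_vec (Suc k)" for v
    proof (rule eq_vecI)
      fix i assume "i < dim_vec (P *\<^sub>v r v + (v $ k) \<cdot>\<^sub>v w)"
      then have i: "i < n" using wc by simp
      have "(P' *\<^sub>v v) $ i = (\<Sum>j<Suc k. P' $$ (i, j) * v $ j)"
        using P'c v i by (auto simp: scalar_prod_def lessThan_atLeast0 intro!: sum.cong)
      also have "\<dots> = (\<Sum>j<k. P $$ (i, j) * v $ j) + w $ i * v $ k"
        using i by (auto simp: P'_def intro!: sum.cong)
      also have "\<dots> = (P *\<^sub>v r v + (v $ k) \<cdot>\<^sub>v w) $ i"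
        using Pc wc i by (auto simp: scalar_prod_def r_def lessThan_atLeast0 intro!: sum.cong)
      finally show "(P' *\<^sub>v v) $ i = (P *\<^sub>v r v + (v $ k) \<cdot>\<^sub>v w) $ i" .
    qed (use P'c wc in auto)
    have "v = 0\<^sub>v (Suc k)" if v: "v \<in> carrier_vec (Suc k)" and z: "P' *\<^sub>v v = 0\<^sub>v n" for v
    proof -
      have eq: "P *\<^sub>v r v + (v $ k) \<cdot>\<^sub>v w = 0\<^sub>v n" using P'v[OF v] z by simp
      \<comment> \<open>With a nonzero last coordinate the relation could be solved for
        \<open>w\<close>, which would put \<open>w\<close> into the image of
        \<open>P\<close>.\<close>
      have vk: "v $ k = 0"
      proof (rule ccontr)
        assume nz: "v $ k \<noteq> 0"
        have "w = P *\<^sub>v ((- 1 / v $ k) \<cdot>\<^sub>v r v)"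
        proof (rule eq_vecI)
          fix i assume "i < dim_vec (P *\<^sub>v ((- 1 / v $ k) \<cdot>\<^sub>v r v))"
          then have i: "i < n" using Pc by simp
          have "(P *\<^sub>v r v) $ i + v $ k * w $ i = 0"
            using arg_cong[OF eq, of "\<lambda>u. u $ i"] i wc Pc by simp
          then have "w $ i = (- 1 / v $ k) * (P *\<^sub>v r v) $ i"
            using nz by (simp add: field_simps eq_neg_iff_add_eq_0)
          then show "w $ i = (P *\<^sub>v ((- 1 / v $ k) \<cdot>\<^sub>v r v)) $ i"
            using i Pc rc[of v] by (simp add: mult_mat_vec)
        qed (use wc Pc in auto)
        then show False using notin rc[of v] by auto
      qed
      have "P *\<^sub>v r v = 0\<^sub>v n"
      proof (rule eq_vecI)
        fix i assume "i < dim_vec (0\<^sub>v n :: 'a vec)"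
        then show "(P *\<^sub>v r v) $ i = 0\<^sub>v n $ i"
          using arg_cong[OF eq, of "\<lambda>u. u $ i"] wc Pc vk by simp
      qed (use Pc in auto)
      then have rz: "r v = 0\<^sub>v k" using mat_injective_zero[OF P rc] by simp
      have "v $ i = 0" if "i < Suc k" for i
        using arg_cong[OF rz, of "\<lambda>u. u $ i"] vk that by (cases "i = k") (auto simp: r_def)
      then show ?thesis using v by (intro eq_vecI) auto
    qed
    moreover have "P' *\<^sub>v v \<in> W" if "v \<in> carrier_vec (Suc k)" for v
      unfolding P'v[OF that] by (intro add smult im rc w)
    ultimately have "Suc k \<in> K"
      using P'c unfolding K_def mat_injective_def by blast
    then show False using Max_ge[OF fin, of "Suc k"] by (simp add: k_def)
  qed
  then have "(\<lambda>v. P *\<^sub>v v) ` carrier_vec k = W" using im by auto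
  then show ?thesis using P that by blast
qed

section \<open>Representations and irreducible subrepresentations\<close>

text \<open>Replaces the unit group of the matrix ring by equations between matrices. From right to
  left, invertibility of \<open>\<rho> g\<close> comes from the matrix of the inverse of
  \<open>g\<close>.\<close>

lemma representation_iff:
  assumes "group G"
  shows "representation G n \<rho> \<longleftrightarrow>
    (\<forall>g \<in> carrier G. \<rho> g \<in> carrier_mat n n) \<and> \<rho> \<one>\<^bsub>G\<^esub> = 1\<^sub>m n \<and>
    (\<forall>g \<in> carrier G. \<forall>h \<in> carrier G. \<rho> (g \<otimes>\<^bsub>G\<^esub> h) = \<rho> g * \<rho> h)"
    (is "?L \<longleftrightarrow> ?R")
proof
  interpret G: group G by fact
  interpret M: ring "ring_mat TYPE(complex) n ()" by (rule ring_mat)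
  let ?U = "units_of (ring_mat TYPE(complex) n ())"
  {
    assume L: ?L
    then interpret group_hom G ?U \<rho>
      using M.units_group G.is_group
      by (auto simp: representation_def group_hom_def group_hom_axioms_def)
    show ?R
      using L hom_one
      by (auto simp: representation_def hom_def units_of_def ring_mat_simps Units_def)
  next
    assume R: ?R
    have "\<rho> g \<in> Units (ring_mat TYPE(complex) n ())" if g: "g \<in> carrier G" for g
    proof -
      have "\<rho> (inv\<^bsub>G\<^esub> g) * \<rho> g = 1\<^sub>m n" "\<rho> g * \<rho> (inv\<^bsub>G\<^esub> g) = 1\<^sub>m n"
        using R g by (metis G.inv_closed G.l_inv, metis G.inv_closed G.r_inv)
      then show ?thesis
        using R g by (auto simp: Units_def ring_mat_simps)
    qed
    then show ?L
      using R by (auto simp: representation_def hom_def units_of_def ring_mat_simps)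
  }
qed

lemma representation_pow:
  assumes "group G" "representation G n \<rho>" "g \<in> carrier G"
  shows "\<rho> (g [^]\<^bsub>G\<^esub> (k :: nat)) = \<rho> g ^\<^sub>m k"
proof -
  interpret group G by fact
  show ?thesis
    using assms by (induction k) (auto simp: representation_iff)
qed

text \<open>The kernel of a representation can be read off its character: the order of the group is
  an exponent for \<open>\<rho> g\<close>, so the trace criterion for matrices of finite order
  applies.\<close>

lemma representation_trivial_iff_trace:
  assumes G: "group G" "finite (carrier G)" and \<rho>: "representation G n \<rho>" and g: "g \<in> carrier G"
  shows "mat_trace (\<rho> g) = of_nat n \<longleftrightarrow> \<rho> g = 1\<^sub>m n"
proof
  interpret group G by fact
  have "\<rho> g ^\<^sub>m Coset.order G = 1\<^sub>m n"
    using representation_pow[OF G(1) \<rho> g, of "Coset.order G"] pow_order_eq_1[OF g] \<rho> G(1)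
    by (simp add: representation_iff)
  moreover have "Coset.order G > 0" using G(2) order_gt_0_iff_finite by simp
  moreover have "\<rho> g \<in> carrier_mat n n" using \<rho> g G(1) by (simp add: representation_iff)
  moreover assume "mat_trace (\<rho> g) = of_nat n"
  ultimately show "\<rho> g = 1\<^sub>m n" using finite_order_mat_trace_maximal by blast
qed (simp add: mat_trace_def)

text \<open>A nonzero invariant subspace of \<open>W\<close> of least dimension is irreducible.
  Writing it as the image of an injective \<open>P\<close>, the matrices \<open>\<sigma> g\<close>
  describe the action in the coordinates given by \<open>P\<close>.\<close>

lemma irreducible_subrepresentation:
  assumes G: "group G" and \<rho>: "representation G n \<rho>"
    and W: "VectorSpace.subspace class_ring W (module_vec TYPE(complex) n)" "W \<noteq> {0\<^sub>v n}"
    and inv: "\<And>g w. g \<in> carrier G \<Longrightarrow> w \<in> W \<Longrightarrow> \<rho> g *\<^sub>v w \<in> W"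
  obtains k \<sigma> P where "irreducible_representation G k \<sigma>" "mat_injective n k P"
    "\<forall>v \<in> carrier_vec k. P *\<^sub>v v \<in> W"
    "\<forall>g \<in> carrier G. \<rho> g * P = P * \<sigma> g"
proof -
  interpret group G by fact
  have \<rho>c: "\<rho> g \<in> carrier_mat n n" if "g \<in> carrier G" for g
    using \<rho> that G by (simp add: representation_iff)
  \<comment> \<open>\<open>stable k P\<close> says that the image of \<open>P\<close> is a
    \<open>k\<close>-dimensional subspace of \<open>W\<close> invariant under
    \<open>\<rho>\<close>.\<close>
  define stable where "stable = (\<lambda>k (P :: complex mat). mat_injective n k P \<and>
     (\<forall>v \<in> carrier_vec k. P *\<^sub>v v \<in> W) \<and>
     (\<forall>g \<in> carrier G. \<forall>v \<in> carrier_vec k. \<exists>u \<in> carrier_vec k. \<rho> g *\<^sub>v (P *\<^sub>v v) = P *\<^sub>v u))"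
  have "\<exists>k. k > 0 \<and> (\<exists>P. stable k P)"
  proof -
    obtain k P where P: "mat_injective n k P" "(\<lambda>v. P *\<^sub>v v) ` carrier_vec k = W"
      by (rule subspace_injective_image[OF W(1)])
    have "k > 0"
    proof (rule ccontr)
      assume "\<not> k > 0"
      then have k: "k = 0" by simp
      have "P *\<^sub>v v = 0\<^sub>v n" if "v \<in> carrier_vec 0" for v :: "complex vec"
        using that mat_injective_carrier[OF P(1)] k by (intro eq_vecI) (auto simp: scalar_prod_def)
      then have "W \<subseteq> {0\<^sub>v n}" using P(2) k by auto
      moreover have "0\<^sub>v n \<in> W" using W(1) by (simp add: subspace_carrier_vec_iff)
      ultimately show False using W(2) by auto
    qed
    moreover have "stable k P"
      unfolding stable_def
    proof (intro conjI ballI)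
      fix g and v :: "complex vec"
      assume "g \<in> carrier G" "v \<in> carrier_vec k"
      then have "\<rho> g *\<^sub>v (P *\<^sub>v v) \<in> (\<lambda>v. P *\<^sub>v v) ` carrier_vec k"
        using inv P(2) by auto
      then show "\<exists>u \<in> carrier_vec k. \<rho> g *\<^sub>v (P *\<^sub>v v) = P *\<^sub>v u" by auto
    qed (use P in auto)
    ultimately show ?thesis by blast
  qed
  from exists_least_iff[THEN iffD1, OF this]
  obtain k P where k: "k > 0" and st: "stable k P"
    and least: "\<And>l Q. l > 0 \<Longrightarrow> stable l Q \<Longrightarrow> k \<le> l"
    by (meson not_le)
  have P: "mat_injective n k P" and PW: "\<And>v. v \<in> carrier_vec k \<Longrightarrow> P *\<^sub>v v \<in> W"
    using st by (auto simp: stable_def)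
  note Pc = mat_injective_carrier[OF P]
  have "\<exists>S. S \<in> carrier_mat k k \<and> \<rho> g * P = P * S" if g: "g \<in> carrier G" for g
  proof -
    have "\<forall>j. \<exists>u. j < k \<longrightarrow> u \<in> carrier_vec k \<and> \<rho> g *\<^sub>v (P *\<^sub>v unit_vec k j) = P *\<^sub>v u"
      using st g unfolding stable_def by (meson unit_vec_carrier)
    then obtain u where u: "\<And>j. j < k \<Longrightarrow> u j \<in> carrier_vec k"
      "\<And>j. j < k \<Longrightarrow> \<rho> g *\<^sub>v (P *\<^sub>v unit_vec k j) = P *\<^sub>v u j"
      by metis
    \<comment> \<open>Column \<open>j\<close> holds the coordinates, with respect to the columns of
      \<open>P\<close>, of the image of the \<open>j\<close>-th column under
      \<open>\<rho> g\<close>.\<close>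
    define S where "S = mat k k (\<lambda>(i, j). u j $ i)"
    have Sc: "S \<in> carrier_mat k k" by (simp add: S_def)
    have "\<rho> g * P = P * S"
    proof (rule mat_col_eqI)
      fix j assume "j < dim_col (P * S)"
      then have j: "j < k" using Sc by simp
      have "col (\<rho> g * P) j = \<rho> g *\<^sub>v (P *\<^sub>v unit_vec k j)"
        unfolding mult_mat_vec_unit[OF Pc j] by (rule col_mult2[OF \<rho>c[OF g] Pc j])
      also have "\<dots> = P *\<^sub>v u j" using u j by simp
      also have "u j = col S j"
        using u(1)[OF j] j by (intro eq_vecI) (auto simp: S_def)
      also have "P *\<^sub>v col S j = col (P * S) j"
        by (rule col_mult2[OF Pc Sc j, symmetric])
      finally show "col (\<rho> g * P) j = col (P * S) j" .
    qed (use \<rho>c[OF g] Pc Sc in auto)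
    then show ?thesis using Sc by blast
  qed
  then obtain \<sigma> where \<sigma>c: "\<And>g. g \<in> carrier G \<Longrightarrow> \<sigma> g \<in> carrier_mat k k"
    and \<sigma>: "\<And>g. g \<in> carrier G \<Longrightarrow> \<rho> g * P = P * \<sigma> g"
    by metis
  \<comment> \<open>The relations holding for \<open>\<rho>\<close> pass to \<open>\<sigma>\<close>
    by moving them across \<open>P\<close> and cancelling the injective \<open>P\<close>.\<close>
  have rep: "representation G k \<sigma>"
    unfolding representation_iff[OF G]
  proof (intro conjI ballI)
    show "\<sigma> \<one>\<^bsub>G\<^esub> = 1\<^sub>m k"
      by (rule mat_injective_cancel[OF P])
        (use \<sigma>[of "\<one>\<^bsub>G\<^esub>"] \<sigma>c[of "\<one>\<^bsub>G\<^esub>"] Pc \<rho> G in \<open>auto simp: representation_iff\<close>)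
    fix g h assume g: "g \<in> carrier G" and h: "h \<in> carrier G"
    have "P * \<sigma> (g \<otimes>\<^bsub>G\<^esub> h) = \<rho> g * \<rho> h * P"
      using \<sigma>[of "g \<otimes>\<^bsub>G\<^esub> h"] g h \<rho> G by (simp add: representation_iff)
    also have "\<dots> = \<rho> g * (P * \<sigma> h)"
      using assoc_mult_mat[OF \<rho>c[OF g] \<rho>c[OF h] Pc] \<sigma>[OF h] by simp
    also have "\<dots> = P * \<sigma> g * \<sigma> h"
      using assoc_mult_mat[OF \<rho>c[OF g] Pc \<sigma>c[OF h]] \<sigma>[OF g] by simp
    also have "\<dots> = P * (\<sigma> g * \<sigma> h)"
      by (rule assoc_mult_mat[OF Pc \<sigma>c[OF g] \<sigma>c[OF h]])
    finally show "\<sigma> (g \<otimes>\<^bsub>G\<^esub> h) = \<sigma> g * \<sigma> h"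
      by (rule mat_injective_cancel[OF P, rotated 2]) (use g h \<sigma>c in \<open>auto intro!: mult_carrier_mat\<close>)
  qed (use \<sigma>c in auto)
  have "U = {0\<^sub>v k} \<or> U = carrier_vec k"
    if U: "VectorSpace.subspace class_ring U (module_vec TYPE(complex) k)"
      and Uinv: "\<forall>g \<in> carrier G. \<forall>w \<in> U. \<sigma> g *\<^sub>v w \<in> U" for U
  proof -
    obtain l Q where Q: "mat_injective k l Q" "(\<lambda>v. Q *\<^sub>v v) ` carrier_vec l = U"
      by (rule subspace_injective_image[OF U])
    note Qc = mat_injective_carrier[OF Q(1)]
    show ?thesis
    proof (cases "l = 0")
      case True
      have "Q *\<^sub>v v = 0\<^sub>v k" if "v \<in> carrier_vec 0" for v :: "complex vec"
        using that Qc True by (intro eq_vecI) (auto simp: scalar_prod_def)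
      then have "U \<subseteq> {0\<^sub>v k}" using Q(2) True by auto
      moreover have "0\<^sub>v k \<in> U" using U by (simp add: subspace_carrier_vec_iff)
      ultimately show ?thesis by auto
    next
      case False
      \<comment> \<open>\<open>P\<close> carries the invariant subspace \<open>U\<close> to an
        invariant subspace of \<open>W\<close> of dimension \<open>l > 0\<close>. Minimality of
        \<open>k\<close> gives \<open>l = k\<close>, so \<open>U\<close> is everything.\<close>
      have "stable l (P * Q)"
        unfolding stable_def
      proof (intro conjI ballI)
        show "mat_injective n l (P * Q)" by (rule mat_injective_mult[OF P Q(1)])
        fix v :: "complex vec" assume v: "v \<in> carrier_vec l"
        then show "P * Q *\<^sub>v v \<in> W" using PW Pc Qc by (simp add: assoc_mult_mat_vec)
        fix g assume g: "g \<in> carrier G"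
        have "\<sigma> g *\<^sub>v (Q *\<^sub>v v) \<in> U" using Uinv g v Q(2) by auto
        then obtain u where u: "u \<in> carrier_vec l" "\<sigma> g *\<^sub>v (Q *\<^sub>v v) = Q *\<^sub>v u"
          using Q(2) by auto
        have "\<rho> g *\<^sub>v (P * Q *\<^sub>v v) = (\<rho> g * P) *\<^sub>v (Q *\<^sub>v v)"
          using \<rho>c[OF g] Pc Qc v by (simp add: assoc_mult_mat_vec[of _ n n _ k] assoc_mult_mat_vec[of _ n k _ l])
        also have "\<dots> = P *\<^sub>v (\<sigma> g *\<^sub>v (Q *\<^sub>v v))"
          unfolding \<sigma>[OF g] using \<sigma>c[OF g] Pc Qc v by (simp add: assoc_mult_mat_vec[of _ n k _ k])
        also have "\<dots> = P * Q *\<^sub>v u"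
          using u Pc Qc by (simp add: assoc_mult_mat_vec[of _ n k _ l])
        finally show "\<exists>u \<in> carrier_vec l. \<rho> g *\<^sub>v (P * Q *\<^sub>v v) = P * Q *\<^sub>v u"
          using u by blast
      qed
      then have "k \<le> l" using least False by blast
      then have "l = k" using mat_injective_le[OF Q(1)] by simp
      then have "U = carrier_vec k" using mat_injective_square_surj Q by blast
      then show ?thesis ..
    qed
  qed
  then have "irreducible_representation G k \<sigma>"
    using rep k unfolding irreducible_representation_def by blast
  then show ?thesis using that P PW \<sigma> by blast
qed

section \<open>Trivial representations and the regular representation\<close>

text \<open>Under the trivial action every subspace is invariant. In dimension above 1 the line
  \<open>U\<close> through the first unit vector is neither zero nor everything.\<close>

lemma irreducible_representation_trivial:
  assumes irr: "irreducible_representation G n \<rho>"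
    and triv: "\<And>g. g \<in> carrier G \<Longrightarrow> \<rho> g = 1\<^sub>m n"
  shows "n = 1"
proof (rule ccontr)
  assume "n \<noteq> 1"
  then have n: "1 < n" using irr by (simp add: irreducible_representation_def)
  define U where "U = range (\<lambda>c :: complex. c \<cdot>\<^sub>v unit_vec n 0)"
  have "VectorSpace.subspace class_ring U (module_vec TYPE(complex) n)"
    unfolding subspace_carrier_vec_iff
  proof (intro conjI ballI allI)
    show "0\<^sub>v n \<in> U" unfolding U_def by (rule range_eqI[of _ _ 0]) auto
  next
    fix v w assume "v \<in> U" "w \<in> U"
    then show "v + w \<in> U"
      unfolding U_def by (auto simp flip: add_smult_distrib_vec)
  next
    fix c v assume "v \<in> U"
    then show "c \<cdot>\<^sub>v v \<in> U"
      unfolding U_def by (auto simp: smult_smult_assoc)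
  qed (auto simp: U_def)
  moreover have "\<forall>g \<in> carrier G. \<forall>w \<in> U. \<rho> g *\<^sub>v w \<in> U"
    using triv by (auto simp: U_def)
  ultimately have "U = {0\<^sub>v n} \<or> U = carrier_vec n"
    using irr unfolding irreducible_representation_def by blast
  then show False
  proof
    assume "U = {0\<^sub>v n}"
    moreover have "unit_vec n 0 \<in> U"
      unfolding U_def by (rule range_eqI[of _ _ 1]) auto
    ultimately show False using n unit_vec_nonzero[of n 0] by auto
  next
    assume "U = carrier_vec n"
    then have "unit_vec n 1 \<in> U" by auto
    then obtain c where "unit_vec n 1 = c \<cdot>\<^sub>v (unit_vec n 0 :: complex vec)"
      unfolding U_def by auto
    from arg_cong[OF this, of "\<lambda>u. u $ 1"] show False using n by simp
  qed
qed

text \<open>The representation is found inside the \<open>N\<close>-invariant functions on \<open>G\<close> of sum zero: these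
  are permuted by \<open>G\<close> since \<open>N\<close> is normal, and the only \<open>G\<close>-fixed one is zero.\<close>

lemma nontrivial_irreducible_representation:
  assumes G: "group G" "finite (carrier G)" and N: "N \<lhd> G" "N \<noteq> carrier G"
  obtains n \<rho> where "irreducible_representation G n \<rho>"
    "\<forall>k \<in> N. \<rho> k = 1\<^sub>m n" "\<exists>g \<in> carrier G. \<rho> g \<noteq> 1\<^sub>m n"
proof -
  interpret group G by fact
  interpret N: normal N G by fact
  define n where "n = card (carrier G)"
  \<comment> \<open>A numbering of the group, which turns functions on it into vectors of length
    \<open>n\<close>; \<open>fv\<close> below is this translation.\<close>
  obtain h where h: "bij_betw h {..<n} (carrier G)"
    using ex_bij_betw_nat_finite[OF G(2)] by (auto simp: n_def lessThan_atLeast0)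
  have hG: "h i \<in> carrier G" if "i < n" for i
    using bij_betwE[OF h] that by auto
  have h_onto: "\<exists>i<n. h i = x" if "x \<in> carrier G" for x
    using bij_betw_imp_surj_on[OF h] that by (metis imageE lessThan_iff)
  have reindex: "(\<Sum>i<n. f (h i)) = (\<Sum>x\<in>carrier G. f x)" for f :: "'a \<Rightarrow> complex"
    by (rule sum.reindex_bij_betw[OF h])
  define fv where "fv = (\<lambda>f :: 'a \<Rightarrow> complex. vec n (\<lambda>i. f (h i)))"
  have fvc: "fv f \<in> carrier_vec n" for f by (simp add: fv_def)
  have fv_eq: "fv f = fv f' \<longleftrightarrow> (\<forall>x \<in> carrier G. f x = f' x)" for f f'
    using h_onto hG by (fastforce simp: fv_def vec_eq_iff)
  \<comment> \<open>The left regular representation as permutation matrices.\<close>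
  define R where "R = (\<lambda>g. mat n n (\<lambda>(i, j). if g \<otimes>\<^bsub>G\<^esub> h j = h i then 1 else 0 :: complex))"
  have Rc: "R g \<in> carrier_mat n n" for g by (simp add: R_def)
  have Rfv: "R g *\<^sub>v fv f = fv (\<lambda>x. f (inv\<^bsub>G\<^esub> g \<otimes>\<^bsub>G\<^esub> x))" if g: "g \<in> carrier G" for g f
  proof (rule eq_vecI)
    fix i assume "i < dim_vec (fv (\<lambda>x. f (inv\<^bsub>G\<^esub> g \<otimes>\<^bsub>G\<^esub> x)))"
    then have i: "i < n" by (simp add: fv_def)
    have "(R g *\<^sub>v fv f) $ i = (\<Sum>j<n. (if g \<otimes>\<^bsub>G\<^esub> h j = h i then 1 else 0) * f (h j))"
      using i by (auto simp: R_def fv_def scalar_prod_def lessThan_atLeast0 intro!: sum.cong)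
    also have "\<dots> = (\<Sum>x\<in>carrier G. (if g \<otimes>\<^bsub>G\<^esub> x = h i then 1 else 0) * f x)"
      by (rule reindex)
    also have "\<dots> = (\<Sum>x\<in>carrier G. if x = inv\<^bsub>G\<^esub> g \<otimes>\<^bsub>G\<^esub> h i then f x else 0)"
    proof (rule sum.cong)
      fix x assume x: "x \<in> carrier G"
      have "g \<otimes>\<^bsub>G\<^esub> x = h i \<longleftrightarrow> x = inv\<^bsub>G\<^esub> g \<otimes>\<^bsub>G\<^esub> h i"
        using inv_solve_left[OF x g hG[OF i]] by auto
      then show "(if g \<otimes>\<^bsub>G\<^esub> x = h i then 1 else 0) * f x =
          (if x = inv\<^bsub>G\<^esub> g \<otimes>\<^bsub>G\<^esub> h i then f x else 0)" by simp
    qed simp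
    also have "\<dots> = fv (\<lambda>x. f (inv\<^bsub>G\<^esub> g \<otimes>\<^bsub>G\<^esub> x)) $ i"
      using g hG[OF i] i G(2) by (simp add: fv_def)
    finally show "(R g *\<^sub>v fv f) $ i = fv (\<lambda>x. f (inv\<^bsub>G\<^esub> g \<otimes>\<^bsub>G\<^esub> x)) $ i" .
  qed (simp add: R_def fv_def)
  have R: "representation G n R"
    unfolding representation_iff[OF G(1)]
  proof (intro conjI ballI)
    have "h i = h j \<longleftrightarrow> i = j" if "i < n" "j < n" for i j
      using h that by (auto simp: bij_betw_def inj_on_def)
    then show "R \<one>\<^bsub>G\<^esub> = 1\<^sub>m n"
      using hG by (intro eq_matI) (auto simp: R_def)
    fix g g' assume g: "g \<in> carrier G" and g': "g' \<in> carrier G"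
    show "R (g \<otimes>\<^bsub>G\<^esub> g') = R g * R g'"
    proof (rule eq_matI)
      fix i j assume "i < dim_row (R g * R g')" "j < dim_col (R g * R g')"
      then have i: "i < n" and j: "j < n" by (auto simp: R_def)
      have "(R g * R g') $$ (i, j) =
          (\<Sum>l<n. (if g \<otimes>\<^bsub>G\<^esub> h l = h i then 1 else 0) * (if g' \<otimes>\<^bsub>G\<^esub> h j = h l then 1 else 0))"
        using i j Rc by (simp del: index_mult_mat add: index_mult_mat_sum[where n=n and m=n and k=n])
          (simp add: R_def)
      also have "\<dots> =
          (\<Sum>x\<in>carrier G. (if g \<otimes>\<^bsub>G\<^esub> x = h i then 1 else 0) * (if g' \<otimes>\<^bsub>G\<^esub> h j = x then 1 else 0))"
        by (rule reindex)
      also have "\<dots> = (\<Sum>x\<in>carrier G. if g' \<otimes>\<^bsub>G\<^esub> h j = x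
          then (if g \<otimes>\<^bsub>G\<^esub> (g' \<otimes>\<^bsub>G\<^esub> h j) = h i then 1 else 0) else 0)"
        by (intro sum.cong) auto
      also have "\<dots> = R (g \<otimes>\<^bsub>G\<^esub> g') $$ (i, j)"
        using g g' hG[OF j] i j G(2) by (simp add: R_def m_assoc)
      finally show "R (g \<otimes>\<^bsub>G\<^esub> g') $$ (i, j) = (R g * R g') $$ (i, j)" by simp
    qed (auto simp: R_def)
  qed (rule Rc)
  define I where "I = {f :: 'a \<Rightarrow> complex.
    (\<forall>k \<in> N. \<forall>x \<in> carrier G. f (k \<otimes>\<^bsub>G\<^esub> x) = f x) \<and> (\<Sum>x\<in>carrier G. f x) = 0}"
  define W where "W = fv ` I"
  have W: "VectorSpace.subspace class_ring W (module_vec TYPE(complex) n)"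
    unfolding subspace_carrier_vec_iff
  proof (intro conjI ballI allI)
    have "0\<^sub>v n = fv (\<lambda>_. 0)" by (auto simp: fv_def)
    then show "0\<^sub>v n \<in> W" unfolding W_def by (rule image_eqI[where f = fv]) (simp add: I_def)
  next
    fix v w assume "v \<in> W" "w \<in> W"
    then obtain f f' where f: "f \<in> I" "f' \<in> I" "v = fv f" "w = fv f'" by (auto simp: W_def)
    then have "v + w = fv (\<lambda>x. f x + f' x)" by (auto simp: fv_def)
    then show "v + w \<in> W"
      unfolding W_def by (rule image_eqI[where f = fv]) (use f in \<open>auto simp: I_def sum.distrib\<close>)
  next
    fix c v assume "v \<in> W"
    then obtain f where f: "f \<in> I" "v = fv f" by (auto simp: W_def)
    then have "c \<cdot>\<^sub>v v = fv (\<lambda>x. c * f x)" by (auto simp: fv_def)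
    then show "c \<cdot>\<^sub>v v \<in> W"
      unfolding W_def
      by (rule image_eqI[where f = fv]) (use f in \<open>auto simp: I_def simp flip: sum_distrib_left\<close>)
  qed (auto simp: W_def fvc)
  have W0: "W \<noteq> {0\<^sub>v n}"
  proof
    assume W0: "W = {0\<^sub>v n}"
    \<comment> \<open>A nonzero element of \<open>I\<close>: a multiple of the indicator function of
      \<open>N\<close>, shifted to have sum zero. Outside \<open>N\<close>, which is a proper
      subset, its value is minus the order of \<open>N\<close>.\<close>
    define f where "f = (\<lambda>x. (if x \<in> N then of_nat n else 0) - of_nat (card N) :: complex)"
    have "(\<Sum>x\<in>carrier G. if x \<in> N then complex_of_nat n else 0) = of_nat (card N * n)"
      using N.subset G(2) by (simp add: sum.If_cases Int_absorb1)
    then have "(\<Sum>x\<in>carrier G. f x) = 0"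
      by (simp add: f_def sum_subtractf n_def)
    moreover have "k \<otimes>\<^bsub>G\<^esub> x \<in> N \<longleftrightarrow> x \<in> N" if k: "k \<in> N" and x: "x \<in> carrier G" for k x
    proof
      assume "k \<otimes>\<^bsub>G\<^esub> x \<in> N"
      then have "inv\<^bsub>G\<^esub> k \<otimes>\<^bsub>G\<^esub> (k \<otimes>\<^bsub>G\<^esub> x) \<in> N" using k by simp
      then show "x \<in> N" using k x by (simp flip: m_assoc)
    qed (use k in simp)
    ultimately have "f \<in> I" by (auto simp: I_def f_def)
    then have "fv f = 0\<^sub>v n" using W0 by (auto simp: W_def)
    also have "0\<^sub>v n = fv (\<lambda>_. 0)" by (auto simp: fv_def)
    finally have "fv f = fv (\<lambda>_. 0)" .
    then have zero: "\<forall>x \<in> carrier G. f x = 0" by (simp only: fv_eq)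
    obtain x where "x \<in> carrier G" "x \<notin> N" using N(2) N.subset by auto
    then have "card N = 0" using zero by (auto simp: f_def)
    then show False using finite_subset[OF N.subset G(2)] N.one_closed by auto
  qed
  have stable: "R g *\<^sub>v w \<in> W" if g: "g \<in> carrier G" and w: "w \<in> W" for g w
  proof -
    obtain f where f: "f \<in> I" "w = fv f" using w by (auto simp: W_def)
    have gG: "inv\<^bsub>G\<^esub> g \<in> carrier G" using g by simp
    have cancel: "g \<otimes>\<^bsub>G\<^esub> (inv\<^bsub>G\<^esub> g \<otimes>\<^bsub>G\<^esub> x) = x" "inv\<^bsub>G\<^esub> g \<otimes>\<^bsub>G\<^esub> (g \<otimes>\<^bsub>G\<^esub> x) = x"
      if "x \<in> carrier G" for x
      using g that by (simp_all flip: m_assoc)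
    have "f (inv\<^bsub>G\<^esub> g \<otimes>\<^bsub>G\<^esub> (k \<otimes>\<^bsub>G\<^esub> x)) = f (inv\<^bsub>G\<^esub> g \<otimes>\<^bsub>G\<^esub> x)" if k: "k \<in> N" and x: "x \<in> carrier G" for k x
    proof -
      \<comment> \<open>Moving \<open>k\<close> to the left past the inverse of \<open>g\<close>
        conjugates it, and the conjugate stays in \<open>N\<close> by normality.\<close>
      have "inv\<^bsub>G\<^esub> g \<otimes>\<^bsub>G\<^esub> (k \<otimes>\<^bsub>G\<^esub> x) = (inv\<^bsub>G\<^esub> g \<otimes>\<^bsub>G\<^esub> k \<otimes>\<^bsub>G\<^esub> g) \<otimes>\<^bsub>G\<^esub> (inv\<^bsub>G\<^esub> g \<otimes>\<^bsub>G\<^esub> x)"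
        using g k x cancel(1)[OF x] by (simp add: m_assoc)
      moreover have "f (k' \<otimes>\<^bsub>G\<^esub> y) = f y" if "k' \<in> N" "y \<in> carrier G" for k' y
        using f(1) that by (simp add: I_def)
      ultimately show ?thesis
        using N.inv_op_closed1[OF g k] m_closed[OF gG x] by simp
    qed
    moreover have "(\<Sum>x\<in>carrier G. f (inv\<^bsub>G\<^esub> g \<otimes>\<^bsub>G\<^esub> x)) = (\<Sum>x\<in>carrier G. f x)"
      by (rule sum.reindex_bij_witness[of _ "\<lambda>x. g \<otimes>\<^bsub>G\<^esub> x" "\<lambda>x. inv\<^bsub>G\<^esub> g \<otimes>\<^bsub>G\<^esub> x"])
        (use g cancel in simp_all)
    ultimately show ?thesis
      using f unfolding f(2) Rfv[OF g] W_def by (intro imageI) (simp add: I_def)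
  qed
  \<comment> \<open>\<open>R k\<close> translates by the inverse of \<open>k\<close>, again an
    element of \<open>N\<close>, under which functions in \<open>I\<close> are invariant.\<close>
  have N_fixes: "R k *\<^sub>v w = w" if "k \<in> N" "w \<in> W" for k w
    using that Rfv[OF N.mem_carrier[OF that(1)]] by (auto simp: W_def I_def fv_eq)
  \<comment> \<open>A function fixed by all translations is constant, and a constant with sum zero
    is zero.\<close>
  have fixed_zero: "w = 0\<^sub>v n" if w: "w \<in> W" and fixed: "\<And>g. g \<in> carrier G \<Longrightarrow> R g *\<^sub>v w = w" for w
  proof -
    obtain f where f: "f \<in> I" "w = fv f" using w by (auto simp: W_def)
    have const: "f x = f \<one>\<^bsub>G\<^esub>" if x: "x \<in> carrier G" for x
      using fixed[OF x] x unfolding f(2) Rfv[OF x] fv_eq by (metis l_inv)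
    have "(\<Sum>x\<in>carrier G. f x) = of_nat n * f \<one>\<^bsub>G\<^esub>"
      using sum.cong[OF refl const, of "carrier G"] by (simp add: n_def)
    then have "f \<one>\<^bsub>G\<^esub> = 0" using f(1) G(2) by (auto simp: n_def I_def)
    then have "fv f = fv (\<lambda>_. 0)" unfolding fv_eq by (intro ballI) (simp only: const)
    then show ?thesis using f(2) by (auto simp: fv_def)
  qed
  obtain k \<sigma> P where irr: "irreducible_representation G k \<sigma>" and P: "mat_injective n k P"
    and "\<forall>v \<in> carrier_vec k. P *\<^sub>v v \<in> W" "\<forall>g \<in> carrier G. R g * P = P * \<sigma> g"
    by (rule irreducible_subrepresentation[OF G(1) R W W0 stable])
  then have PW: "\<And>v. v \<in> carrier_vec k \<Longrightarrow> P *\<^sub>v v \<in> W"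
    and \<sigma>: "\<And>g. g \<in> carrier G \<Longrightarrow> R g * P = P * \<sigma> g" by simp_all
  note Pc = mat_injective_carrier[OF P]
  have k: "k > 0" and rep: "representation G k \<sigma>"
    using irr by (simp_all add: irreducible_representation_def)
  have \<sigma>c: "\<sigma> g \<in> carrier_mat k k" if "g \<in> carrier G" for g
    using rep that by (simp add: representation_iff[OF G(1)])
  have act: "R g *\<^sub>v (P *\<^sub>v v) = P *\<^sub>v (\<sigma> g *\<^sub>v v)" if "g \<in> carrier G" "v \<in> carrier_vec k" for g v
    using assoc_mult_mat_vec[OF Rc Pc that(2), of g] assoc_mult_mat_vec[OF Pc \<sigma>c[OF that(1)] that(2)]
      \<sigma>[OF that(1)] by metis
  have "\<sigma> g = 1\<^sub>m k" if g: "g \<in> N" for g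
  proof (rule mat_col_eqI)
    fix j assume "j < dim_col (1\<^sub>m k :: complex mat)"
    then have j: "j < k" by simp
    have gG: "g \<in> carrier G" using g by (rule N.mem_carrier)
    have "P *\<^sub>v (\<sigma> g *\<^sub>v unit_vec k j) = P *\<^sub>v unit_vec k j"
      using act[OF gG, of "unit_vec k j"] N_fixes[OF g PW, of "unit_vec k j"] by simp
    then have "\<sigma> g *\<^sub>v unit_vec k j = unit_vec k j"
      by (rule mat_injective_vec_eq[OF P, rotated 2]) (use \<sigma>c[OF gG] in auto)
    then show "col (\<sigma> g) j = col (1\<^sub>m k) j"
      using mult_mat_vec_unit[OF \<sigma>c[OF gG] j] j by simp
  qed (use \<sigma>c[OF N.mem_carrier[OF g]] in auto)
  \<comment> \<open>If \<open>\<sigma>\<close> were trivial, the first column of \<open>P\<close>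
    would be a nonzero vector of \<open>W\<close> fixed by the whole group.\<close>
  moreover have "\<exists>g \<in> carrier G. \<sigma> g \<noteq> 1\<^sub>m k"
  proof (rule ccontr)
    assume "\<not> ?thesis"
    then have "R g *\<^sub>v (P *\<^sub>v unit_vec k 0) = P *\<^sub>v unit_vec k 0" if "g \<in> carrier G" for g
      using act[OF that, of "unit_vec k 0"] that by simp
    then have "P *\<^sub>v unit_vec k 0 = 0\<^sub>v n"
      using fixed_zero[OF PW] by simp
    then show False using mat_injective_zero[OF P, of "unit_vec k 0"] k by simp
  qed
  ultimately show ?thesis using that[OF irr] by simp
qed

section \<open>Conjugacy classes and rows of vertical cuts\<close>

lemma conjugacy_classes_iff:
  "K \<in> conjugacy_classes G \<longleftrightarrow>
    (\<exists>x \<in> carrier G. K = (\<lambda>g. g \<otimes>\<^bsub>G\<^esub> x \<otimes>\<^bsub>G\<^esub> inv\<^bsub>G\<^esub> g) ` carrier G)"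
  by (auto simp: conjugacy_classes_def orbits_def orbit_def image_def Bex_def)

lemma (in group) conjugacy_class_subset:
  assumes "K \<in> conjugacy_classes G"
  shows "K \<subseteq> carrier G"
  using assms by (auto simp: conjugacy_classes_iff)

lemma (in group) conjugacy_class_closed:
  assumes "K \<in> conjugacy_classes G" "x \<in> K" "g \<in> carrier G"
  shows "g \<otimes> x \<otimes> inv g \<in> K"
proof -
  obtain y a where y: "y \<in> carrier G" "a \<in> carrier G" "x = a \<otimes> y \<otimes> inv a"
    and K: "K = (\<lambda>g. g \<otimes> y \<otimes> inv g) ` carrier G"
    using assms by (auto simp: conjugacy_classes_iff)
  have "g \<otimes> x \<otimes> inv g = (g \<otimes> a) \<otimes> y \<otimes> inv (g \<otimes> a)"
    using y assms(3) by (simp add: m_assoc inv_mult_group)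
  then show ?thesis using K y assms(3) by auto
qed

lemma (in group) conjugacy_class_one: "{\<one>} \<in> conjugacy_classes G"
  unfolding conjugacy_classes_iff by (rule bexI[of _ \<one>]) auto

lemma (in group) Union_conjugacy_classes: "\<Union>(conjugacy_classes G) = carrier G"
proof
  show "carrier G \<subseteq> \<Union>(conjugacy_classes G)"
  proof
    fix x assume x: "x \<in> carrier G"
    then have "x \<in> (\<lambda>g. g \<otimes> x \<otimes> inv g) ` carrier G"
      by (intro image_eqI[of _ _ \<one>]) auto
    then show "x \<in> \<Union>(conjugacy_classes G)"
      using x conjugacy_classes_iff by blast
  qed
qed (use conjugacy_class_subset in auto)

text \<open>Conjugate elements have similar matrices, so a character maps a class to a singleton and
  \<open>the_elem\<close> in \<open>character_table\<close> returns its value.\<close>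

lemma character_table_eq_mat_trace:
  assumes G: "group G" and \<rho>: "representation G n \<rho>"
    and K: "K \<in> conjugacy_classes G" and x: "x \<in> K"
  shows "character_table (character_of G \<rho>) K = mat_trace (\<rho> x)"
proof -
  interpret group G by fact
  obtain y where y: "y \<in> carrier G" and K_eq: "K = (\<lambda>g. g \<otimes>\<^bsub>G\<^esub> y \<otimes>\<^bsub>G\<^esub> inv\<^bsub>G\<^esub> g) ` carrier G"
    using K by (auto simp: conjugacy_classes_iff)
  have tr: "mat_trace (\<rho> z) = mat_trace (\<rho> y)" if z: "z \<in> K" for z
  proof -
    obtain g where g: "g \<in> carrier G" "z = g \<otimes>\<^bsub>G\<^esub> y \<otimes>\<^bsub>G\<^esub> inv\<^bsub>G\<^esub> g" using z K_eq by auto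
    have "\<rho> z = \<rho> g * \<rho> y * \<rho> (inv\<^bsub>G\<^esub> g)"
      using \<rho> g y by (simp add: representation_iff[OF G])
    moreover have "\<rho> (inv\<^bsub>G\<^esub> g) * \<rho> g = 1\<^sub>m n"
      using \<rho> g unfolding representation_iff[OF G] by (metis inv_closed l_inv)
    ultimately show ?thesis
      using \<rho> g y by (simp add: mat_trace_similar[of _ n] representation_iff[OF G])
  qed
  have "character_of G \<rho> ` K = {mat_trace (\<rho> x)}"
    using tr x conjugacy_class_subset[OF K] by (force simp: character_of_def)
  then show ?thesis by (simp add: character_table_def)
qed

text \<open>The entry in the column of the identity is the degree \<open>n\<close>. So the row is
  constant iff all its entries are \<open>n\<close>, which the trace criterion translates into
  triviality of the matrices.\<close>

lemma all_entries_equal_cut_row_iff: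
  assumes G: "group G" "finite (carrier G)" and \<rho>: "representation G n \<rho>"
    and C: "C \<subseteq> conjugacy_classes G" "{\<one>\<^bsub>G\<^esub>} \<in> C"
  shows "all_entries_equal C (cut_row C (character_of G \<rho>)) \<longleftrightarrow> (\<forall>x \<in> \<Union>C. \<rho> x = 1\<^sub>m n)"
proof -
  interpret group G by fact
  have one: "character_table (character_of G \<rho>) {\<one>\<^bsub>G\<^esub>} = of_nat n"
    using character_table_eq_mat_trace[OF G(1) \<rho> conjugacy_class_one, of "\<one>\<^bsub>G\<^esub>"] \<rho>
    by (simp add: representation_iff[OF G(1)] mat_trace_def)
  have entry: "character_table (character_of G \<rho>) K = of_nat n \<longleftrightarrow> \<rho> x = 1\<^sub>m n"
    if "K \<in> C" "x \<in> K" for K x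
  proof -
    have K: "K \<in> conjugacy_classes G" using that C by blast
    then have "x \<in> carrier G" using that conjugacy_class_subset by blast
    then show ?thesis
      using character_table_eq_mat_trace[OF G(1) \<rho> K that(2)]
        representation_trivial_iff_trace[OF G \<rho>, of x] by simp
  qed
  \<comment> \<open>An entry can be computed from the matrices only through an element of the
    class.\<close>
  have nonempty: "\<exists>x. x \<in> K" if "K \<in> C" for K
    using subsetD[OF C(1) that] one_closed unfolding conjugacy_classes_iff by blast
  have "all_entries_equal C (cut_row C (character_of G \<rho>)) \<longleftrightarrow>
      (\<forall>K \<in> C. \<forall>L \<in> C. character_table (character_of G \<rho>) K = character_table (character_of G \<rho>) L)"
    by (simp add: all_entries_equal_def cut_row_def)
  also have "\<dots> \<longleftrightarrow> (\<forall>K \<in> C. character_table (character_of G \<rho>) K = of_nat n)"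
    using C(2) one by metis
  also have "\<dots> \<longleftrightarrow> (\<forall>x \<in> \<Union>C. \<rho> x = 1\<^sub>m n)"
    using entry nonempty by (meson UnionE UnionI)
  finally show ?thesis .
qed

text \<open>The value at the identity is the degree, so a representation with principal character
  has degree 1 and all traces equal to its degree. Conversely, irreducibility forces a trivial
  representation to have degree 1.\<close>

lemma character_of_eq_principal_iff:
  assumes G: "group G" "finite (carrier G)" and irr: "irreducible_representation G n \<rho>"
  shows "character_of G \<rho> = principal_character G \<longleftrightarrow> (\<forall>g \<in> carrier G. \<rho> g = 1\<^sub>m n)"
proof
  interpret group G by fact
  have rep: "representation G n \<rho>" using irr by (simp add: irreducible_representation_def)
  {
    assume "character_of G \<rho> = principal_character G"
    then have tr: "mat_trace (\<rho> g) = 1" if "g \<in> carrier G" for g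
      using that by (auto simp: character_of_def principal_character_def dest: fun_cong[of _ _ g])
    have "mat_trace (\<rho> \<one>\<^bsub>G\<^esub>) = of_nat n"
      using rep by (simp add: representation_iff[OF G(1)] mat_trace_def)
    then have "n = 1" using tr[of "\<one>\<^bsub>G\<^esub>"] by simp
    then show "\<forall>g \<in> carrier G. \<rho> g = 1\<^sub>m n"
      using tr representation_trivial_iff_trace[OF G rep] by simp
  next
    assume triv: "\<forall>g \<in> carrier G. \<rho> g = 1\<^sub>m n"
    then have "n = 1" using irreducible_representation_trivial[OF irr] by blast
    then show "character_of G \<rho> = principal_character G"
      using triv by (auto simp: character_of_def principal_character_def mat_trace_def)
  }
qed

lemma only_first_row_constant_iff:
  assumes G: "group G" "finite (carrier G)"
    and C: "C \<subseteq> conjugacy_classes G" "{\<one>\<^bsub>G\<^esub>} \<in> C"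
  shows "only_first_row_constant G C \<longleftrightarrow> classes_generate G C"
proof
  interpret group G by fact
  have UC: "\<Union>C \<subseteq> carrier G" using C conjugacy_class_subset by blast
  {
    assume gen: "classes_generate G C"
    show "only_first_row_constant G C"
      unfolding only_first_row_constant_def
    proof (intro ballI notI)
      fix \<chi> assume \<chi>: "\<chi> \<in> irreducible_characters G - {principal_character G}"
        and const: "all_entries_equal C (cut_row C \<chi>)"
      then obtain n \<rho> where irr: "irreducible_representation G n \<rho>" and \<chi>_eq: "\<chi> = character_of G \<rho>"
        by (auto simp: irreducible_characters_def)
      have rep: "representation G n \<rho>" using irr by (simp add: irreducible_representation_def)
      \<comment> \<open>The kernel of \<open>\<rho>\<close> contains the classes in
        \<open>C\<close>, and being a subgroup it contains what they generate.\<close>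
      have "\<rho> x = 1\<^sub>m n" if "x \<in> generate G (\<Union>C)" for x
        using that
      proof (induction rule: generate.induct)
        case one
        then show ?case using rep by (simp add: representation_iff[OF G(1)])
      next
        case (incl x)
        then show ?case
          using const \<chi>_eq all_entries_equal_cut_row_iff[OF G rep C] by blast
      next
        case (inv x)
        then have x: "x \<in> carrier G" "\<rho> x = 1\<^sub>m n"
          using UC const \<chi>_eq all_entries_equal_cut_row_iff[OF G rep C] by auto
        have "\<rho> (inv\<^bsub>G\<^esub> x) * \<rho> x = 1\<^sub>m n"
          using rep x(1) unfolding representation_iff[OF G(1)] by (metis inv_closed l_inv)
        moreover have "\<rho> (inv\<^bsub>G\<^esub> x) \<in> carrier_mat n n"
          using rep x(1) by (simp add: representation_iff[OF G(1)])
        ultimately show ?case using x(2) by simp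
      next
        case (eng x y)
        then show ?case
          using rep generate_in_carrier[OF UC] by (simp add: representation_iff[OF G(1)])
      qed
      then have "\<chi> = principal_character G"
        using gen character_of_eq_principal_iff[OF G irr] \<chi>_eq by (simp add: classes_generate_def)
      then show False using \<chi> by simp
    qed
  next
    assume only: "only_first_row_constant G C"
    define N where "N = generate G (\<Union>C)"
    have N: "N \<lhd> G"
      unfolding N_def
    \<comment> \<open>A union of conjugacy classes is closed under conjugation, so it generates a
      normal subgroup.\<close>
    proof (rule normal_generateI[OF UC])
      fix x g assume "x \<in> \<Union>C" "g \<in> carrier G"
      then show "g \<otimes>\<^bsub>G\<^esub> x \<otimes>\<^bsub>G\<^esub> inv\<^bsub>G\<^esub> g \<in> \<Union>C"
        using C conjugacy_class_closed by blast
    qed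
    have "N = carrier G"
    proof (rule ccontr)
      assume "N \<noteq> carrier G"
      then obtain n \<rho> where irr: "irreducible_representation G n \<rho>"
        and ker: "\<forall>k \<in> N. \<rho> k = 1\<^sub>m n" and nontriv: "\<exists>g \<in> carrier G. \<rho> g \<noteq> 1\<^sub>m n"
        by (rule nontrivial_irreducible_representation[OF G N])
      have rep: "representation G n \<rho>" using irr by (simp add: irreducible_representation_def)
      have "character_of G \<rho> \<in> irreducible_characters G - {principal_character G}"
        using irr nontriv character_of_eq_principal_iff[OF G irr]
        by (auto simp: irreducible_characters_def)
      moreover have "all_entries_equal C (cut_row C (character_of G \<rho>))"
        using ker all_entries_equal_cut_row_iff[OF G rep C] by (auto simp: N_def intro: generate.incl)
      ultimately show False using only by (auto simp: only_first_row_constant_def)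
    qed
    then show "classes_generate G C"
      using C by (simp add: classes_generate_def N_def)
  }
qed

section \<open>Counting columns and generating classes\<close>

lemma classes_generate_insert_one:
  assumes "group G"
  shows "classes_generate G (insert {\<one>\<^bsub>G\<^esub>} S) \<longleftrightarrow> classes_generate G S"
proof -
  interpret group G by fact
  have "generate G (insert \<one>\<^bsub>G\<^esub> (\<Union>S)) = generate G (\<Union>S)" if "S \<subseteq> conjugacy_classes G"
  proof
    have "\<Union>S \<subseteq> carrier G" using that conjugacy_class_subset by blast
    then show "generate G (insert \<one>\<^bsub>G\<^esub> (\<Union>S)) \<subseteq> generate G (\<Union>S)"
      by (intro generate_subgroup_incl generate_is_subgroup) (auto intro: generate.intros)
  qed (rule mono_generate, auto)
  then show ?thesis
    using conjugacy_class_one by (auto simp: classes_generate_def)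
qed

text \<open>The column of the identity belongs to every cut but is not counted in \<open>d\<close>.
  Removing it gives exactly \<open>d\<close> classes, and adding it back gives \<open>1 + d\<close>
  columns provided it was absent before.\<close>

lemma vertical_cut_only_first_row_constant_iff:
  assumes G: "group G" "finite (carrier G)"
  shows "(\<exists>C. vertical_cut G d C \<and> only_first_row_constant G C) \<longleftrightarrow>
    (\<exists>S. finite S \<and> card S = d \<and> {\<one>\<^bsub>G\<^esub>} \<notin> S \<and> classes_generate G S)"
proof
  interpret group G by fact
  {
    assume "\<exists>C. vertical_cut G d C \<and> only_first_row_constant G C"
    then obtain C where C: "C \<subseteq> conjugacy_classes G" "{\<one>\<^bsub>G\<^esub>} \<in> C" "finite C" "card C = 1 + d"
      and "only_first_row_constant G C" by (auto simp: vertical_cut_def)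
    then have "classes_generate G (insert {\<one>\<^bsub>G\<^esub>} (C - {{\<one>\<^bsub>G\<^esub>}}))"
      using only_first_row_constant_iff[OF G C(1,2)] by (simp add: insert_absorb)
    then have "classes_generate G (C - {{\<one>\<^bsub>G\<^esub>}})"
      by (simp only: classes_generate_insert_one[OF G(1)])
    then show "\<exists>S. finite S \<and> card S = d \<and> {\<one>\<^bsub>G\<^esub>} \<notin> S \<and> classes_generate G S"
      using C by (intro exI[of _ "C - {{\<one>\<^bsub>G\<^esub>}}"]) auto
  next
    assume "\<exists>S. finite S \<and> card S = d \<and> {\<one>\<^bsub>G\<^esub>} \<notin> S \<and> classes_generate G S"
    then obtain S where S: "finite S" "card S = d" "{\<one>\<^bsub>G\<^esub>} \<notin> S" "classes_generate G S" by blast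
    define C where "C = insert {\<one>\<^bsub>G\<^esub>} S"
    have "C \<subseteq> conjugacy_classes G"
      using S(4) conjugacy_class_one by (simp add: C_def classes_generate_def)
    moreover have "classes_generate G C"
      using S(4) classes_generate_insert_one[OF G(1)] by (simp add: C_def)
    ultimately show "\<exists>C. vertical_cut G d C \<and> only_first_row_constant G C"
      using S only_first_row_constant_iff[OF G, of C]
      by (intro exI[of _ C]) (auto simp: C_def vertical_cut_def)
  }
qed

theorem proposition1:
  fixes G :: "('a, 'm) monoid_scheme" and d :: nat
  assumes "group G" and "finite (carrier G)"
  shows "class_generating_number G = d \<longleftrightarrow>
    (\<exists>C. vertical_cut G d C \<and> only_first_row_constant G C) \<and>
    (\<forall>d' < d. \<not> (\<exists>C. vertical_cut G d' C \<and> only_first_row_constant G C))"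
proof -
  interpret group G by fact
  \<comment> \<open>\<open>P\<close> is the property minimised by the class generating number.
    \<open>Q\<close> in addition excludes the class of the identity and so corresponds to vertical
    cuts; the aim is to show that both have the same least element.\<close>
  define P where "P = (\<lambda>d. \<exists>S. finite S \<and> card S = d \<and> classes_generate G S)"
  define Q where "Q = (\<lambda>d. \<exists>S. finite S \<and> card S = d \<and> {\<one>\<^bsub>G\<^esub>} \<notin> S \<and> classes_generate G S)"
  define m where "m = (LEAST d. P d)"
  have QP: "P e" if "Q e" for e using that by (auto simp: P_def Q_def)
  have least: "m \<le> e" if "P e" for e using that by (simp add: m_def Least_le)
  \<comment> \<open>The set of all classes generates, so \<open>P\<close> holds somewhere and its
    least element exists.\<close>
  have "finite (conjugacy_classes G)"
    using assms(2) Union_conjugacy_classes by (metis finite_UnionD)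
  moreover have "classes_generate G (conjugacy_classes G)"
    unfolding classes_generate_def Union_conjugacy_classes
    using generate_incl[OF order_refl] by (auto intro: generate.incl)
  ultimately have "P (card (conjugacy_classes G))" by (auto simp: P_def)
  then have "P m" unfolding m_def by (rule LeastI)
  then obtain S where S: "finite S" "card S = m" "classes_generate G S" by (auto simp: P_def)
  \<comment> \<open>Dropping the class of the identity from a smallest generating set leaves a
    generating set, whose size cannot fall below \<open>m\<close>; hence \<open>Q m\<close>.\<close>
  have "classes_generate G (insert {\<one>\<^bsub>G\<^esub>} (S - {{\<one>\<^bsub>G\<^esub>}}))"
    using S(3) classes_generate_insert_one[OF assms(1), of S] by simp
  then have "classes_generate G (S - {{\<one>\<^bsub>G\<^esub>}})"
    by (simp only: classes_generate_insert_one[OF assms(1)])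
  then have Q': "Q (card (S - {{\<one>\<^bsub>G\<^esub>}}))" using S(1) by (auto simp: Q_def)
  moreover have "card (S - {{\<one>\<^bsub>G\<^esub>}}) \<le> m" using S by (metis card_Diff1_le)
  ultimately have "Q m" using least[OF QP[OF Q']] by simp
  have "class_generating_number G = m"
    by (simp add: class_generating_number_def m_def P_def)
  moreover have "m = d \<longleftrightarrow> Q d \<and> (\<forall>d' < d. \<not> Q d')"
    using \<open>Q m\<close> least QP by (metis le_antisym not_le)
  ultimately show ?thesis
    by (simp only: vertical_cut_only_first_row_constant_iff[OF assms] Q_def)
qed

end
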